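(* Let $\tilde\eta,\tilde\nu,\tilde\tau$ be non-negative functions, analytic in a neighborhood of $0$, and for $q\geq 0$ small put $\eta=\tilde\eta(\sqrt q)$, $\nu=\tilde\nu(\sqrt q)$, $\tau=\tilde\tau(\sqrt q)$, $\zeta=1+(1-\tau)\sqrt q$, and $$\mathbf I=\zeta\nu(\tau+\zeta\eta\sqrt q)-\tau^2,\qquad\mathbf{II}=\tau(\nu\tau-2\zeta\eta)+\zeta\eta(\nu\tau-\zeta\eta)\sqrt q.$$ Denote the Taylor expansions of $\mathbf I$ and $\mathbf{II}$ in $\sqrt q$ by $\mathbf I=\sum_{n\ge0}a_n(\sqrt q)^n$ and $\mathbf{II}=\sum_{m\ge0}b_m(\sqrt q)^m$. When $\mathbf I$ is not identically $0$, let $N$ be the minimal $n$ with $a_n\ne0$; when $\mathbf{II}$ is not identically $0$, let $M$ be the minimal $m$ with $b_m\ne0$. Then: (ia) If $a_N>0$, $b_M<0$ and $M\le N-2$, then $\mathbf I>0$ and $\mathbf I+\sqrt q\,\mathbf{II}\le0$ for $0<q\lesssim\mu/L$. (ib) If $a_N>0$, $b_M<0$, $M=N-1$, and the first nonzero element of $\{a_n+b_{n-1}\}_{n\ge N}$ is negative or this entire sequence is $0$, then $\mathbf I>0$ and $\mathbf I+\sqrt q\,\mathbf{II}\le0$ for $0<q\lesssim\mu/L$. (iia) If $a_N<0$, $b_M>0$ and $M=N$, then $\mathbf{II}>0$ and $\frac\mu L\mathbf I+\sqrt q\,\mathbf{II}\le0$ for $0<q\lesssim\mu^2/L^2$. (iib)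 If $a_N<0$, $b_M>0$ and $M\ge N+1$, then $\mathbf{II}>0$ and $\frac\mu L\mathbf I+\sqrt q\,\mathbf{II}\le0$ for $0<q\lesssim\mu/L$. (iii) If $a_N<0$ (or $N$ does not exist) and $b_M<0$ (or $M$ does not exist), then $\mathbf I\le0$ and $\mathbf{II}\le0$ for $0<q\lesssim\mu/L$.
   Context: Here $0<\mu\le L$ are arbitrary. A statement "holds for $0<q\lesssim\mu/L$" (respectively $0<q\lesssim\mu^2/L^2$) means: there is a constant $C_0>0$, depending only on $(\tilde\eta,\tilde\nu,\tilde\tau)$, such that it holds for all $0<\mu\le L$ and all $0<q\le C_0\mu/L$ (respectively $0<q\le C_0\mu^2/L^2$). In (ia)–(iib), the hypotheses include that $N$ and $M$ exist. *)

theory Defs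
  imports "HOL-Analysis.Analysis"
begin

(* The library's analytic_on concerns complex functions only. *)
definition real_analytic_on :: "(real \<Rightarrow> real) \<Rightarrow> real set \<Rightarrow> bool" where
  "real_analytic_on f U \<longleftrightarrow> (\<forall>x\<in>U. \<exists>F. (\<lambda>h. f (x + h)) has_fps_expansion F)"

(* The functions are only ever evaluated at sqrt q, so non-negativity is demanded at the
   points s \<ge> 0 of the neighbourhood only: f s = s is admissible. *)
definition nonneg_analytic_near_0 :: "(real \<Rightarrow> real) \<Rightarrow> bool" where
  "nonneg_analytic_near_0 f \<longleftrightarrow>
     (\<exists>U. open U \<and> 0 \<in> U \<and> real_analytic_on f U \<and> (\<forall>s\<in>U. 0 \<le> s \<longrightarrow> 0 \<le> f s))"

(* In zeta, bold_I and bold_II the last argument s stands for sqrt q. *)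
definition zeta :: "(real \<Rightarrow> real) \<Rightarrow> real \<Rightarrow> real" where
  "zeta \<tau> s = 1 + (1 - \<tau> s) * s"

definition bold_I ::
    "(real \<Rightarrow> real) \<Rightarrow> (real \<Rightarrow> real) \<Rightarrow> (real \<Rightarrow> real) \<Rightarrow> real \<Rightarrow> real" where
  "bold_I \<eta> \<nu> \<tau> s = zeta \<tau> s * \<nu> s * (\<tau> s + zeta \<tau> s * \<eta> s * s) - (\<tau> s)\<^sup>2"

definition bold_II ::
    "(real \<Rightarrow> real) \<Rightarrow> (real \<Rightarrow> real) \<Rightarrow> (real \<Rightarrow> real) \<Rightarrow> real \<Rightarrow> real" where
  "bold_II \<eta> \<nu> \<tau> s =
     \<tau> s * (\<nu> s * \<tau> s - 2 * zeta \<tau> s * \<eta> s)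
     + zeta \<tau> s * \<eta> s * (\<nu> s * \<tau> s - zeta \<tau> s * \<eta> s) * s"

definition taylor_coeff :: "(real \<Rightarrow> real) \<Rightarrow> nat \<Rightarrow> real" where
  "taylor_coeff f n = (deriv ^^ n) f 0 / fact n"

definition first_nonzero :: "(nat \<Rightarrow> real) \<Rightarrow> nat \<Rightarrow> bool" where
  "first_nonzero c n \<longleftrightarrow> c n \<noteq> 0 \<and> (\<forall>k<n. c k = 0)"

(* "P holds for 0 < q \<lesssim> r \<mu> L": the constant C0 is chosen before \<mu>, L and q. *)
definition holds_for_lesssim ::
    "(real \<Rightarrow> real \<Rightarrow> real) \<Rightarrow> (real \<Rightarrow> real \<Rightarrow> real \<Rightarrow> bool) \<Rightarrow> bool" where
  "holds_for_lesssim r P \<longleftrightarrow>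
     (\<exists>C0>0. \<forall>\<mu> L q. 0 < \<mu> \<and> \<mu> \<le> L \<and> 0 < q \<and> q \<le> C0 * r \<mu> L \<longrightarrow> P \<mu> L q)"

lemma taylor_coeff_eq_fps_nth:
  assumes "f has_fps_expansion F"
  shows "taylor_coeff f n = fps_nth F n"
  using assms
proof (induction n arbitrary: f F)
  case 0
  then show ?case
    by (auto simp: taylor_coeff_def has_fps_expansion_def eval_fps_at_0 dest: eventually_nhds_x_imp_x)
next
  case (Suc n)
  have "taylor_coeff (deriv f) n = fps_nth (fps_deriv F) n"
    using Suc.prems by (intro Suc.IH has_fps_expansion_deriv)
  then have "(deriv ^^ Suc n) f 0 / fact n = real (Suc n) * fps_nth F (Suc n)"
    by (simp add: taylor_coeff_def funpow_Suc_right del: funpow.simps of_nat_Suc)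
  then have "(deriv ^^ Suc n) f 0 = fact (Suc n) * fps_nth F (Suc n)"
    by (simp add: divide_eq_eq mult.commute mult.left_commute del: funpow.simps of_nat_Suc)
  then show ?case
    by (simp add: taylor_coeff_def del: funpow.simps fact_Suc)
qed

lemma bold_I_bold_II_taylor_expansion:
  assumes "nonneg_analytic_near_0 \<eta>" "nonneg_analytic_near_0 \<nu>" "nonneg_analytic_near_0 \<tau>"
  shows "bold_I \<eta> \<nu> \<tau> has_fps_expansion Abs_fps (taylor_coeff (bold_I \<eta> \<nu> \<tau>))"
    and "bold_II \<eta> \<nu> \<tau> has_fps_expansion Abs_fps (taylor_coeff (bold_II \<eta> \<nu> \<tau>))"
proof -
  have ex: "\<exists>F. f has_fps_expansion F" if "nonneg_analytic_near_0 f" for f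
    using that by (fastforce simp: nonneg_analytic_near_0_def real_analytic_on_def)
  obtain E V T where [fps_expansion_intros]: "\<eta> has_fps_expansion E" "\<nu> has_fps_expansion V"
    "\<tau> has_fps_expansion T"
    using ex assms by meson
  have expand: "f has_fps_expansion Abs_fps (taylor_coeff f)" if "f has_fps_expansion F" for f F
  proof -
    have "Abs_fps (taylor_coeff f) = F"
      using taylor_coeff_eq_fps_nth[OF that] by (intro fps_ext) simp
    with that show ?thesis by simp
  qed
  show "bold_I \<eta> \<nu> \<tau> has_fps_expansion Abs_fps (taylor_coeff (bold_I \<eta> \<nu> \<tau>))"
    by (rule expand, unfold bold_I_def zeta_def power2_eq_square)
      (rule fps_expansion_intros)+
  show "bold_II \<eta> \<nu> \<tau> has_fps_expansion Abs_fps (taylor_coeff (bold_II \<eta> \<nu> \<tau>))"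
    by (rule expand, unfold bold_II_def zeta_def)
      (rule fps_expansion_intros)+
qed

end

theory Submission
  imports Defs
begin

text \<open>
  The sign of a convergent power series at small \<open>s > 0\<close> is that of its first nonzero coefficient;
  the first part of each case follows from this at once. In (ia) and (ib) it also applies to
  \<open>I + s II\<close>, which vanishes or has leading coefficient \<open>b\<^sub>M\<close> or the first nonzero \<open>a\<^sub>n + b\<^sub>n\<^sub>-\<^sub>1\<close>. In (iia) and
  (iib), put \<open>j = 1\<close> and \<open>j = 2\<close> respectively: for large \<open>K\<close> the series \<open>K s\<^sup>j I + s II\<close> has a
  negative leading coefficient at \<open>s\<^sup>N\<^sup>+\<^sup>j\<close>, and \<open>\<mu>/L I \<le> K s\<^sup>j I\<close> as soon as \<open>K s\<^sup>j \<le> \<mu>/L\<close>, which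
  with \<open>s = sqrt q\<close> amounts to \<open>q \<lesssim> \<mu>\<^sup>2/L\<^sup>2\<close> and \<open>q \<lesssim> \<mu>/L\<close>.
\<close>

lemma fps_expansion_eventually_pos:
  fixes f :: "real \<Rightarrow> real"
  assumes f: "f has_fps_expansion Abs_fps c"
    and n: "first_nonzero c n" "c n > 0"
  shows "eventually (\<lambda>s. f s > 0) (at_right 0)"
proof -
  have "Abs_fps c \<noteq> 0"
    using n(2) by (auto simp: fps_eq_iff intro: exI[of _ n])
  then have "n \<le> subdegree (Abs_fps c)"
    using n by (intro subdegree_geI) (auto simp: first_nonzero_def)
  then have "(\<lambda>s. if s = 0 then c n else f s / s ^ n) has_fps_expansion fps_shift n (Abs_fps c)"
    using f by (intro has_fps_expansion_shift) auto
  then have "continuous (at_right 0) (\<lambda>s. if s = 0 then c n else f s / s ^ n)"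
    by (rule has_fps_expansion_imp_continuous)
  then have "((\<lambda>s. if s = 0 then c n else f s / s ^ n) \<longlongrightarrow> c n) (at_right 0)"
    by (simp add: continuous_within)
  then have "eventually (\<lambda>s. (if s = 0 then c n else f s / s ^ n) > 0) (at_right 0)"
    using n(2) by (rule order_tendstoD)
  moreover have "eventually (\<lambda>s::real. s > 0) (at_right 0)"
    by (rule eventually_at_right_less)
  ultimately show ?thesis
    by eventually_elim (simp add: zero_less_divide_iff)
qed

lemma fps_expansion_eventually_neg:
  fixes f :: "real \<Rightarrow> real"
  assumes f: "f has_fps_expansion Abs_fps c" and n: "first_nonzero c n" "c n < 0"
  shows "eventually (\<lambda>s. f s < 0) (at_right 0)"
proof -
  have "(\<lambda>s. - f s) has_fps_expansion Abs_fps (\<lambda>n. - c n)"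
    by (rule has_fps_expansion_schematicI[OF has_fps_expansion_minus[OF f]])
      (simp add: fps_eq_iff)
  from fps_expansion_eventually_pos[OF this, of n] n show ?thesis
    by (simp add: first_nonzero_def)
qed

lemma fps_expansion_eventually_nonpos:
  fixes f :: "real \<Rightarrow> real"
  assumes f: "f has_fps_expansion Abs_fps c"
    and c: "(\<exists>n. first_nonzero c n \<and> c n < 0) \<or> (\<nexists>n. first_nonzero c n)"
  shows "eventually (\<lambda>s. f s \<le> 0) (at_right 0)"
  using c
proof
  assume "\<exists>n. first_nonzero c n \<and> c n < 0"
  then obtain n where "first_nonzero c n" "c n < 0"
    by blast
  from fps_expansion_eventually_neg[OF f this] show ?thesis
    by (rule eventually_mono) simp
next
  assume none: "\<nexists>n. first_nonzero c n"
  have "c n = 0" for n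
    using none by (induction n rule: less_induct) (auto simp: first_nonzero_def)
  then have "Abs_fps c = 0"
    by (simp add: fps_eq_iff)
  then have "eventually (\<lambda>s. 0 = f s) (nhds 0)"
    using f by (simp add: has_fps_expansion_def)
  then have "eventually (\<lambda>s. f s \<le> 0) (nhds 0)"
    by (rule eventually_mono) simp
  then show ?thesis
    by (simp add: eventually_at_filter eventually_mono)
qed

lemma fps_expansion_weighted_sum:
  fixes f g :: "real \<Rightarrow> real"
  assumes "f has_fps_expansion Abs_fps a" "g has_fps_expansion Abs_fps b"
  shows "(\<lambda>s. K * s ^ j * f s + s * g s) has_fps_expansion
    Abs_fps (\<lambda>n. K * (if n < j then 0 else a (n - j)) + (if n = 0 then 0 else b (n - 1)))"
proof (rule has_fps_expansion_schematicI)
  show "(\<lambda>s. K * s ^ j * f s + s * g s) has_fps_expansion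
    fps_const K * fps_X ^ j * Abs_fps a + fps_X * Abs_fps b"
    by (intro fps_expansion_intros assms)
qed (simp add: fps_eq_iff fps_X_power_mult_nth mult.assoc)

lemma eventually_imp_holds_for_lesssim:
  assumes P: "eventually P (at_right 0)" and c: "c > 0"
    and r: "\<And>\<mu> L. 0 < \<mu> \<Longrightarrow> \<mu> \<le> L \<Longrightarrow> r \<mu> L \<le> 1"
    and PQ: "\<And>\<mu> L q. 0 < \<mu> \<Longrightarrow> \<mu> \<le> L \<Longrightarrow> 0 < q \<Longrightarrow> q \<le> c * r \<mu> L \<Longrightarrow> P (sqrt q) \<Longrightarrow> Q \<mu> L q"
  shows "holds_for_lesssim r Q"
proof -
  obtain d where d: "d > 0" "\<And>s. 0 < s \<Longrightarrow> s < d \<Longrightarrow> P s"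
    using P by (auto simp: eventually_at_right_field)
  define C where "C = min c (d\<^sup>2 / 2)"
  have "C > 0"
    using c d(1) by (simp add: C_def)
  moreover have "Q \<mu> L q" if *: "0 < \<mu>" "\<mu> \<le> L" "0 < q" "q \<le> C * r \<mu> L" for \<mu> L q
  proof -
    have "C * r \<mu> L > 0"
      using * by linarith
    then have "r \<mu> L > 0"
      using \<open>C > 0\<close> by (simp add: zero_less_mult_iff)
    then have "C * r \<mu> L \<le> c * r \<mu> L"
      by (simp add: C_def)
    moreover have "C * r \<mu> L \<le> C * 1"
      using r[OF *(1,2)] \<open>C > 0\<close> by (intro mult_left_mono) auto
    moreover have "C < d\<^sup>2"
      using d(1) by (auto simp: C_def min_less_iff_disj)
    ultimately have "q \<le> c * r \<mu> L" "q < d\<^sup>2"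
      using * by auto
    then show ?thesis
      using * d by (intro PQ d(2)) (auto intro: real_less_lsqrt)
  qed
  ultimately show ?thesis
    unfolding holds_for_lesssim_def by blast
qed

lemma square_ratio_le_1:
  fixes \<mu> L :: real
  assumes "0 < \<mu>" "\<mu> \<le> L"
  shows "\<mu>\<^sup>2 / L\<^sup>2 \<le> 1"
  using assms by (simp add: power_mono)

lemma weighted_sum_eventually_nonpos:
  fixes f g :: "real \<Rightarrow> real"
  assumes f: "f has_fps_expansion Abs_fps a" and g: "g has_fps_expansion Abs_fps b"
    and a: "first_nonzero a N" "a N < 0" and b: "\<forall>m<M. b m = 0" and j: "N + j \<le> M + 1" "j > 0"
  obtains K where "K > 0" "eventually (\<lambda>s. K * s ^ j * f s + s * g s \<le> 0) (at_right 0)"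
proof
  define K where "K = (\<bar>b (N + j - 1)\<bar> + 1) / (- a N)"
  let ?c = "\<lambda>n. K * (if n < j then 0 else a (n - j)) + (if n = 0 then 0 else b (n - 1))"
  show "K > 0"
    using a(2) by (simp add: K_def divide_pos_neg)
  have "K * a N = - \<bar>b (N + j - 1)\<bar> - 1"
    using a(2) by (simp add: K_def field_simps)
  then have lead: "?c (N + j) < 0"
    using j(2) by simp
  have low: "?c k = 0" if "k < N + j" for k
    using that a(1) b j by (auto simp: first_nonzero_def)
  have "first_nonzero ?c (N + j)"
    unfolding first_nonzero_def using less_imp_neq[OF lead] low by blast
  from fps_expansion_eventually_neg[OF fps_expansion_weighted_sum[OF f g] this lead]
  show "eventually (\<lambda>s. K * s ^ j * f s + s * g s \<le> 0) (at_right 0)"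
    by (rule eventually_mono) simp
qed

theorem lemmaS1:
  fixes \<eta> \<nu> \<tau> :: "real \<Rightarrow> real"
    and I II :: "real \<Rightarrow> real"
    and a b :: "nat \<Rightarrow> real"
  assumes "nonneg_analytic_near_0 \<eta>"
    and "nonneg_analytic_near_0 \<nu>"
    and "nonneg_analytic_near_0 \<tau>"
  defines "I \<equiv> bold_I \<eta> \<nu> \<tau>"
    and "II \<equiv> bold_II \<eta> \<nu> \<tau>"
  defines "a \<equiv> taylor_coeff I"
    and "b \<equiv> taylor_coeff II"
  shows
    "(\<forall>N M. first_nonzero a N \<and> first_nonzero b M \<and> a N > 0 \<and> b M < 0 \<and> M + 2 \<le> N \<longrightarrow>
        holds_for_lesssim (\<lambda>\<mu> L. \<mu> / L)
          (\<lambda>\<mu> L q. I (sqrt q) > 0 \<and> I (sqrt q) + sqrt q * II (sqrt q) \<le> 0))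
     \<and>
     (\<forall>N M. first_nonzero a N \<and> first_nonzero b M \<and> a N > 0 \<and> b M < 0 \<and> M + 1 = N \<and>
        ((\<exists>n\<ge>N. a n + b (n - 1) < 0 \<and> (\<forall>k. N \<le> k \<and> k < n \<longrightarrow> a k + b (k - 1) = 0))
         \<or> (\<forall>n\<ge>N. a n + b (n - 1) = 0)) \<longrightarrow>
        holds_for_lesssim (\<lambda>\<mu> L. \<mu> / L)
          (\<lambda>\<mu> L q. I (sqrt q) > 0 \<and> I (sqrt q) + sqrt q * II (sqrt q) \<le> 0))
     \<and>
     (\<forall>N M. first_nonzero a N \<and> first_nonzero b M \<and> a N < 0 \<and> b M > 0 \<and> M = N \<longrightarrow>
        holds_for_lesssim (\<lambda>\<mu> L. \<mu>\<^sup>2 / L\<^sup>2)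
          (\<lambda>\<mu> L q. II (sqrt q) > 0 \<and> \<mu> / L * I (sqrt q) + sqrt q * II (sqrt q) \<le> 0))
     \<and>
     (\<forall>N M. first_nonzero a N \<and> first_nonzero b M \<and> a N < 0 \<and> b M > 0 \<and> N + 1 \<le> M \<longrightarrow>
        holds_for_lesssim (\<lambda>\<mu> L. \<mu> / L)
          (\<lambda>\<mu> L q. II (sqrt q) > 0 \<and> \<mu> / L * I (sqrt q) + sqrt q * II (sqrt q) \<le> 0))
     \<and>
     (((\<exists>N. first_nonzero a N \<and> a N < 0) \<or> (\<nexists>N. first_nonzero a N)) \<and>
      ((\<exists>M. first_nonzero b M \<and> b M < 0) \<or> (\<nexists>M. first_nonzero b M)) \<longrightarrow>
        holds_for_lesssim (\<lambda>\<mu> L. \<mu> / L)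
          (\<lambda>\<mu> L q. I (sqrt q) \<le> 0 \<and> II (sqrt q) \<le> 0))"
proof -
  have I: "I has_fps_expansion Abs_fps a" and II: "II has_fps_expansion Abs_fps b"
    using bold_I_bold_II_taylor_expansion[OF assms(1-3)] by (simp_all add: I_def II_def a_def b_def)
  have ratio: "\<mu> / L \<le> 1" if "0 < \<mu>" "\<mu> \<le> L" for \<mu> L :: real
    using that by simp
  have sums: "(\<lambda>s. I s + s * II s) has_fps_expansion
      Abs_fps (\<lambda>n. a n + (if n = 0 then 0 else b (n - 1)))"
    using fps_expansion_weighted_sum[OF I II, of 1 0] by simp
  have case_i: "holds_for_lesssim (\<lambda>\<mu> L. \<mu> / L)
      (\<lambda>\<mu> L q. I (sqrt q) > 0 \<and> I (sqrt q) + sqrt q * II (sqrt q) \<le> 0)"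
    if N: "first_nonzero a N" "a N > 0"
      and sum: "(\<exists>n. first_nonzero (\<lambda>n. a n + (if n = 0 then 0 else b (n - 1))) n
          \<and> a n + (if n = 0 then 0 else b (n - 1)) < 0)
        \<or> (\<nexists>n. first_nonzero (\<lambda>n. a n + (if n = 0 then 0 else b (n - 1))) n)" for N
  proof (rule eventually_imp_holds_for_lesssim[OF _ zero_less_one ratio])
    have "eventually (\<lambda>s. I s + s * II s \<le> 0) (at_right 0)"
      using sum by (rule fps_expansion_eventually_nonpos[OF sums])
    moreover have "eventually (\<lambda>s. I s > 0) (at_right 0)"
      using N by (rule fps_expansion_eventually_pos[OF I])
    ultimately show "eventually (\<lambda>s. I s > 0 \<and> I s + s * II s \<le> 0) (at_right 0)"
      by eventually_elim simp
  qed
  have case_ii: "holds_for_lesssim r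
      (\<lambda>\<mu> L q. II (sqrt q) > 0 \<and> \<mu> / L * I (sqrt q) + sqrt q * II (sqrt q) \<le> 0)"
    if N: "first_nonzero a N" "a N < 0" and M: "first_nonzero b M" "b M > 0"
      and j: "N + j \<le> M + 1" "j > 0"
      and r: "\<And>\<mu> L. 0 < \<mu> \<Longrightarrow> \<mu> \<le> L \<Longrightarrow> r \<mu> L \<le> 1"
      and c: "\<And>K. K > 0 \<Longrightarrow> c K > 0"
      and small: "\<And>K \<mu> L q. K > 0 \<Longrightarrow> 0 < \<mu> \<Longrightarrow> \<mu> \<le> L \<Longrightarrow> 0 < q \<Longrightarrow> q \<le> c K * r \<mu> L
        \<Longrightarrow> K * sqrt q ^ j \<le> \<mu> / L"
    for N M j r and c :: "real \<Rightarrow> real"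
  proof -
    have "\<forall>m<M. b m = 0"
      using M by (simp add: first_nonzero_def)
    then obtain K where K: "K > 0" "eventually (\<lambda>s. K * s ^ j * I s + s * II s \<le> 0) (at_right 0)"
      using weighted_sum_eventually_nonpos[OF I II N _ j] by blast
    have "eventually (\<lambda>s. II s > 0) (at_right 0)"
      using M by (rule fps_expansion_eventually_pos[OF II])
    moreover have "eventually (\<lambda>s. I s < 0) (at_right 0)"
      using N by (rule fps_expansion_eventually_neg[OF I])
    ultimately have ev: "eventually (\<lambda>s. II s > 0 \<and> I s < 0 \<and> K * s ^ j * I s + s * II s \<le> 0)
        (at_right 0)"
      using K(2) by eventually_elim simp
    show ?thesis
    proof (rule eventually_imp_holds_for_lesssim[OF ev c[OF K(1)] r])
      fix \<mu> L q :: real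
      assume q: "0 < \<mu>" "\<mu> \<le> L" "0 < q" "q \<le> c K * r \<mu> L"
        and *: "II (sqrt q) > 0 \<and> I (sqrt q) < 0
          \<and> K * sqrt q ^ j * I (sqrt q) + sqrt q * II (sqrt q) \<le> 0"
      have "\<mu> / L * I (sqrt q) \<le> K * sqrt q ^ j * I (sqrt q)"
        using * small[OF K(1) q] by (intro mult_right_mono_neg) auto
      with * show "II (sqrt q) > 0 \<and> \<mu> / L * I (sqrt q) + sqrt q * II (sqrt q) \<le> 0"
        by linarith
    qed
  qed
  show ?thesis
  proof (intro conjI allI impI; (elim conjE)?)
    fix N M
    assume N: "first_nonzero a N" "a N > 0" and M: "first_nonzero b M" "b M < 0"
      and "M + 2 \<le> N"
    then have "first_nonzero (\<lambda>n. a n + (if n = 0 then 0 else b (n - 1))) (M + 1)"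
      "a (M + 1) + (if M + 1 = 0 then 0 else b (M + 1 - 1)) < 0"
      by (auto simp: first_nonzero_def)
    then show "holds_for_lesssim (\<lambda>\<mu> L. \<mu> / L)
        (\<lambda>\<mu> L q. I (sqrt q) > 0 \<and> I (sqrt q) + sqrt q * II (sqrt q) \<le> 0)"
      by (intro case_i[OF N] disjI1 exI[of _ "M + 1"] conjI)
  next
    fix N M
    assume N: "first_nonzero a N" "a N > 0" and M: "first_nonzero b M" "b M < 0"
      and MN: "M + 1 = N"
      and sum: "(\<exists>n\<ge>N. a n + b (n - 1) < 0 \<and> (\<forall>k. N \<le> k \<and> k < n \<longrightarrow> a k + b (k - 1) = 0))
        \<or> (\<forall>n\<ge>N. a n + b (n - 1) = 0)"
    define c where "c = (\<lambda>n. a n + (if n = 0 then 0 else b (n - 1)))"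
    have low: "c k = 0" if "k < N" for k
      using that N M MN by (auto simp: first_nonzero_def c_def)
    have high: "c n = a n + b (n - 1)" if "n \<ge> N" for n
      using that MN by (auto simp: c_def)
    have "(\<exists>n. first_nonzero c n \<and> c n < 0) \<or> (\<nexists>n. first_nonzero c n)"
      using sum
    proof
      assume "\<exists>n\<ge>N. a n + b (n - 1) < 0 \<and> (\<forall>k. N \<le> k \<and> k < n \<longrightarrow> a k + b (k - 1) = 0)"
      then obtain n where n: "n \<ge> N" "c n < 0" "\<And>k. N \<le> k \<Longrightarrow> k < n \<Longrightarrow> c k = 0"
        by (auto simp: high)
      have "c k = 0" if "k < n" for k
        using low n(3) that by (cases "k < N") auto
      with n(2) have "first_nonzero c n"
        by (simp add: first_nonzero_def)
      with n(2) show ?thesis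
        by blast
    next
      assume "\<forall>n\<ge>N. a n + b (n - 1) = 0"
      then have "c n = 0" for n
        using low high by (cases "n < N") auto
      then show ?thesis
        by (simp add: first_nonzero_def)
    qed
    then show "holds_for_lesssim (\<lambda>\<mu> L. \<mu> / L)
        (\<lambda>\<mu> L q. I (sqrt q) > 0 \<and> I (sqrt q) + sqrt q * II (sqrt q) \<le> 0)"
      unfolding c_def
      by (rule case_i[OF N])
  next
    fix N M
    assume N: "first_nonzero a N" "a N < 0" and M: "first_nonzero b M" "b M > 0" and "M = N"
    then have j: "N + 1 \<le> M + 1" "(1::nat) > 0"
      by simp_all
    show "holds_for_lesssim (\<lambda>\<mu> L. \<mu>\<^sup>2 / L\<^sup>2)
        (\<lambda>\<mu> L q. II (sqrt q) > 0 \<and> \<mu> / L * I (sqrt q) + sqrt q * II (sqrt q) \<le> 0)"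
    proof (rule case_ii[where c = "\<lambda>K. 1 / K\<^sup>2", OF N M j square_ratio_le_1])
      fix K \<mu> L q :: real
      assume "K > 0" "0 < \<mu>" "\<mu> \<le> L" "q \<le> 1 / K\<^sup>2 * (\<mu>\<^sup>2 / L\<^sup>2)"
      then have "sqrt q \<le> \<mu> / (K * L)"
        by (intro real_le_lsqrt) (auto simp: power_divide power_mult_distrib)
      then have "K * sqrt q \<le> K * (\<mu> / (K * L))"
        using \<open>K > 0\<close> by (intro mult_left_mono) auto
      then show "K * sqrt q ^ 1 \<le> \<mu> / L"
        using \<open>K > 0\<close> by simp
    qed simp_all
  next
    fix N M
    assume N: "first_nonzero a N" "a N < 0" and M: "first_nonzero b M" "b M > 0" and "N + 1 \<le> M"
    then have j: "N + 2 \<le> M + 1" "(2::nat) > 0"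
      by simp_all
    show "holds_for_lesssim (\<lambda>\<mu> L. \<mu> / L)
        (\<lambda>\<mu> L q. II (sqrt q) > 0 \<and> \<mu> / L * I (sqrt q) + sqrt q * II (sqrt q) \<le> 0)"
    proof (rule case_ii[where c = "\<lambda>K. 1 / K", OF N M j ratio])
      fix K \<mu> L q :: real
      assume "K > 0" "0 < q" "q \<le> 1 / K * (\<mu> / L)"
      then have "K * q \<le> K * (1 / K * (\<mu> / L))"
        by (intro mult_left_mono) auto
      then show "K * sqrt q ^ 2 \<le> \<mu> / L"
        using \<open>K > 0\<close> \<open>0 < q\<close> by simp
    qed simp_all
  next
    assume a: "(\<exists>N. first_nonzero a N \<and> a N < 0) \<or> (\<nexists>N. first_nonzero a N)"
      and b: "(\<exists>M. first_nonzero b M \<and> b M < 0) \<or> (\<nexists>M. first_nonzero b M)"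
    show "holds_for_lesssim (\<lambda>\<mu> L. \<mu> / L) (\<lambda>\<mu> L q. I (sqrt q) \<le> 0 \<and> II (sqrt q) \<le> 0)"
    proof (rule eventually_imp_holds_for_lesssim[OF _ zero_less_one ratio])
      have "eventually (\<lambda>s. I s \<le> 0) (at_right 0)"
        using a by (rule fps_expansion_eventually_nonpos[OF I])
      moreover have "eventually (\<lambda>s. II s \<le> 0) (at_right 0)"
        using b by (rule fps_expansion_eventually_nonpos[OF II])
      ultimately show "eventually (\<lambda>s. I s \<le> 0 \<and> II s \<le> 0) (at_right 0)"
        by eventually_elim simp
    qed
  qed
qed

end
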